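(* Let $n\ge 2$, let $f:\mathbb{R}^n\to\mathbb{R}$ be $f(x)=|x^{(1)}|+\sum_{i=2}^n x^{(i)}$, and let $0<c_1<c_2<1$. Consider the BFGS method with the Armijo--Wolfe line search with parameters $c_1,c_2$, applied to $f$ from an arbitrary starting point $x_0\in\mathbb{R}^n$ and an arbitrary symmetric positive definite initial inverse Hessian approximation $H_0$. Assume that the step sizes are chosen such that $f$ is differentiable at every iterate, i.e. $x_k^{(1)}\neq 0$ for all iterates $x_k$ (including $x_0$). Then the algorithm terminates in finitely many iterations; that is, there is an iteration $k$ in which no step size $\alpha_k>0$ satisfying the Armijo--Wolfe conditions exists.
   Context: $x^{(i)}$ denotes the $i$-th component of $x\in\mathbb{R}^n$. BFGS method with Armijo--Wolfe line search: given $x_0$ and symmetric positive definite $H_0$, at iteration $k=0,1,2,\dots$ compute the search direction $p_k=-H_k\nabla f(x_k)$; choose (any) step size $\alpha_k>0$ such that $f$ is differentiable at $x_k+\alpha_kp_k$ and the Armijo--Wolfe conditions hold: $$f(x_k+\alpha_kp_k)\le f(x_k)+c_1\alpha_k\nabla f(x_k)^\top p_k\quad\text{(sufficient decrease)},\qquad \nabla f(x_k+\alpha_kp_k)^\top p_k\ge c_2\nabla f(x_k)^\top p_k\quad\text{(curvature)};$$ set $x_{k+1}=x_k+\alpha_kp_k$, $s_k=x_{k+1}-x_k$, $y_k=\nabla f(x_{k+1})-\nabla f(x_k)$, $\rho_k=(s_k^\top y_k)^{-1}$ and $$H_{k+1}=(I-\rho_ks_ky_k^\top)H_k(I-\rho_ky_ks_k^\top)+\rho_ks_ks_k^\top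 .$$ The algorithm is said to terminate (at iteration $k$) if there is no step size $\alpha_k>0$ satisfying the Armijo--Wolfe conditions at iteration $k$. *)

theory Defs
  imports "HOL-Analysis.Analysis"
begin

text \<open>Only meaningful at points where \<open>f\<close> is differentiable; see \<open>GDERIV_gradient\<close>.\<close>

definition gradient :: "('a::real_inner \<Rightarrow> real) \<Rightarrow> 'a \<Rightarrow> 'a" where
  "gradient f x = (THE g. GDERIV f x :> g)"

lemma gradient_eq:
  assumes "GDERIV f x :> g"
  shows "gradient f x = g"
  unfolding gradient_def
proof (rule the_equality)
  show "GDERIV f x :> g"
    by (rule assms)
next
  fix h assume "GDERIV f x :> h"
  then have "(\<lambda>v. v \<bullet> h) = (\<lambda>v. v \<bullet> g)"
    using assms unfolding gderiv_def by (rule has_derivative_unique)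
  then have "(h - g) \<bullet> h = (h - g) \<bullet> g"
    by (rule fun_cong)
  then have "(h - g) \<bullet> (h - g) = 0"
    by (simp only: inner_diff_right diff_self)
  then show "h = g"
    by simp
qed

lemma GDERIV_gradient:
  fixes f :: "'a::euclidean_space \<Rightarrow> real"
  assumes "f differentiable (at x)"
  shows "GDERIV f x :> gradient f x"
proof -
  obtain D where D: "(f has_derivative D) (at x)"
    using assms unfolding differentiable_def by blast
  define g where "g = (\<Sum>b\<in>Basis. D b *\<^sub>R b)"
  have lin: "linear D"
    using D by (rule has_derivative_linear)
  have "D v = v \<bullet> g" for v
  proof -
    have "D v = D (\<Sum>b\<in>Basis. (v \<bullet> b) *\<^sub>R b)"
      by (simp only: euclidean_representation)
    also have "\<dots> = (\<Sum>b\<in>Basis. (v \<bullet> b) * D b)"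
      by (simp only: linear_sum[OF lin] linear_scale[OF lin] real_scaleR_def)
    also have "\<dots> = v \<bullet> g"
      by (simp only: g_def inner_sum_right inner_scaleR_right mult.commute)
    finally show ?thesis .
  qed
  then have "D = (\<lambda>v. v \<bullet> g)"
    by (rule ext)
  then have "GDERIV f x :> g"
    using D unfolding gderiv_def by (simp only:)
  then show ?thesis
    by (simp only: gradient_eq)
qed

definition outer_product :: "real ^ 'm \<Rightarrow> real ^ 'n \<Rightarrow> real ^ 'n ^ 'm" where
  "outer_product u v = (\<chi> i j. u $ i * v $ j)"

definition sym_pos_def :: "real ^ 'n ^ 'n \<Rightarrow> bool" where
  "sym_pos_def A \<longleftrightarrow> transpose A = A \<and> (\<forall>v. v \<noteq> 0 \<longrightarrow> v \<bullet> (A *v v) > 0)"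

text \<open>The curvature condition refers to the gradient at the trial point, so a step size is only
  admissible if \<open>f\<close> is differentiable there.\<close>

definition armijo_wolfe ::
  "real \<Rightarrow> real \<Rightarrow> (real ^ 'n \<Rightarrow> real) \<Rightarrow> real ^ 'n \<Rightarrow> real ^ 'n \<Rightarrow> real \<Rightarrow> bool" where
  "armijo_wolfe c1 c2 f x p \<alpha> \<longleftrightarrow>
     \<alpha> > 0 \<and>
     f differentiable (at (x + \<alpha> *\<^sub>R p)) \<and>
     f (x + \<alpha> *\<^sub>R p) \<le> f x + c1 * \<alpha> * (gradient f x \<bullet> p) \<and>
     gradient f (x + \<alpha> *\<^sub>R p) \<bullet> p \<ge> c2 * (gradient f x \<bullet> p)"

definition bfgs_direction :: "(real ^ 'n \<Rightarrow> real) \<Rightarrow> real ^ 'n \<Rightarrow> real ^ 'n ^ 'n \<Rightarrow> real ^ 'n" where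
  "bfgs_direction f x H = - (H *v gradient f x)"

definition bfgs_update :: "real ^ 'n ^ 'n \<Rightarrow> real ^ 'n \<Rightarrow> real ^ 'n \<Rightarrow> real ^ 'n ^ 'n" where
  "bfgs_update H s y =
     (let \<rho> = inverse (s \<bullet> y) in
       (mat 1 - \<rho> *\<^sub>R outer_product s y) ** H ** (mat 1 - \<rho> *\<^sub>R outer_product y s)
         + \<rho> *\<^sub>R outer_product s s)"

definition bfgs_terminates_at ::
  "real \<Rightarrow> real \<Rightarrow> (real ^ 'n \<Rightarrow> real) \<Rightarrow> (nat \<Rightarrow> real ^ 'n) \<Rightarrow> (nat \<Rightarrow> real ^ 'n ^ 'n) \<Rightarrow> nat \<Rightarrow> bool"
where
  "bfgs_terminates_at c1 c2 f x H k \<longleftrightarrow>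
     (\<nexists>\<alpha>. armijo_wolfe c1 c2 f (x k) (bfgs_direction f (x k) (H k)) \<alpha>)"

text \<open>A run is given by total sequences; the values after the first terminating iteration
  are unconstrained, so finite and infinite executions are both covered.\<close>

definition bfgs_run ::
  "real \<Rightarrow> real \<Rightarrow> (real ^ 'n \<Rightarrow> real) \<Rightarrow> real ^ 'n \<Rightarrow> real ^ 'n ^ 'n \<Rightarrow>
   (nat \<Rightarrow> real ^ 'n) \<Rightarrow> (nat \<Rightarrow> real ^ 'n ^ 'n) \<Rightarrow> (nat \<Rightarrow> real) \<Rightarrow> bool" where
  "bfgs_run c1 c2 f x0 H0 x H \<alpha> \<longleftrightarrow>
     x 0 = x0 \<and> H 0 = H0 \<and>
     (\<forall>k. (\<forall>j\<le>k. \<not> bfgs_terminates_at c1 c2 f x H j) \<longrightarrow>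
        armijo_wolfe c1 c2 f (x k) (bfgs_direction f (x k) (H k)) (\<alpha> k) \<and>
        x (Suc k) = x k + \<alpha> k *\<^sub>R bfgs_direction f (x k) (H k) \<and>
        H (Suc k) = bfgs_update (H k) (x (Suc k) - x k)
                      (gradient f (x (Suc k)) - gradient f (x k)))"

text \<open>The index \<open>a\<close> plays the role of the first coordinate.\<close>

definition abs_plus_sum :: "'n::finite \<Rightarrow> real ^ 'n \<Rightarrow> real" where
  "abs_plus_sum a x = \<bar>x $ a\<bar> + (\<Sum>i\<in>UNIV - {a}. x $ i)"

end

theory Submission
  imports Defs
begin

text \<open>
  The objective has the form \<open>f x = \<bar>x \<bullet> e\<bar> + x \<bullet> w\<close> with \<open>e\<close> and \<open>w\<close> linearly
  independent, and termination is proved for every function of this form.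

  Away from the kink \<open>x \<bullet> e = 0\<close> the gradient is \<open>u + w\<close> with \<open>u = sgn (x \<bullet> e) *\<^sub>R e\<close>. As long as the
  line search succeeds, the curvature condition forces every step to cross the kink
  (\<open>armijo_wolfe_crosses_kink\<close>), so \<open>u\<close> changes sign at each iteration and the gradient difference
  is always \<open>-2 *\<^sub>R u\<close>. The BFGS update then acts on the plane spanned by \<open>e\<close> and \<open>w\<close> in closed form.
  Write \<open>g = u + w\<close>, \<open>p = - H g\<close>, and let

  \<^item> \<open>r = (w \<bullet> p) / (u \<bullet> p)\<close> compare the slopes of the linear and of the kinked part along the step,
  \<^item> \<open>E = q \<bullet> H q\<close> where \<open>q = w - r u\<close> is the vector of this form that is \<open>H\<close>-conjugate to \<open>g\<close>,
  \<^item> \<open>\<xi> = \<bar>x \<bullet> e\<bar>\<close> be the distance to the kink, and \<open>t = (\<xi> + \<xi>') / 2\<close>, half the width of the crossing,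

  with a prime for the next iterate. The update yields \<open>t (1 - r) (r + r') = E\<close> and
  \<open>E' = E + t (r + r')\<^sup>2\<close>, hence \<open>E' / E = (1 + r') / (1 - r)\<close>. Positive definiteness gives \<open>-1 < r\<close>, and
  the fact that the next step also crosses the kink gives \<open>r < 1\<close>. Sufficient decrease reads
  \<open>\<xi> \<ge> t (1 - r + c1 (1 + r))\<close>; it bounds the growth of \<open>\<xi>\<close> by
  \<open>\<xi>' / \<xi> \<le> (1 - c1) (1 + r) / (1 - r)\<close>.

  The quotient \<open>\<xi> (1 + r) / E\<close> is therefore multiplied by at most \<open>1 - c1\<close> in each iteration and
  tends to zero. On the other hand \<open>E = t (1 - r) (r + r') \<le> 2 \<xi>\<close>, so \<open>1 + r\<close> tends to zero as well,
  which contradicts \<open>r + r' > 0\<close> (\<open>no_infinite_scalar_run\<close>).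
\<close>

section \<open>The quadratic form of the BFGS update\<close>

lemma outer_product_mult_vec: "outer_product u v *v z = (v \<bullet> z) *\<^sub>R (u :: real ^ 'm)"
  by (simp add: outer_product_def vec_eq_iff matrix_vector_mult_def inner_vec_def
      sum_distrib_left sum_distrib_right mult_ac)

text \<open>Passing to the bilinear form turns the matrix product into a substitution of vectors, so that
  symmetry, definiteness and individual entries of the update can be read off.\<close>

lemma inner_bfgs_update:
  fixes H :: "real ^ 'n ^ 'n"
  defines "\<rho> s y \<equiv> inverse (s \<bullet> y)"
  shows "u \<bullet> (bfgs_update H s y *v v) =
     (u - (\<rho> s y * (s \<bullet> u)) *\<^sub>R y) \<bullet> (H *v (v - (\<rho> s y * (s \<bullet> v)) *\<^sub>R y)) + \<rho> s y * (s \<bullet> u) * (s \<bullet> v)"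
proof -
  let ?r = "\<rho> s y"
  let ?z = "H *v (v - (?r * (s \<bullet> v)) *\<^sub>R y)"
  have "(mat 1 - ?r *\<^sub>R outer_product y s) *v v = v - (?r * (s \<bullet> v)) *\<^sub>R y"
    by (simp add: matrix_vector_mult_diff_rdistrib outer_product_mult_vec
        flip: scaleR_matrix_vector_assoc)
  then have "bfgs_update H s y *v v = (mat 1 - ?r *\<^sub>R outer_product s y) *v ?z + (?r * (s \<bullet> v)) *\<^sub>R s"
    by (simp add: bfgs_update_def Let_def \<rho>_def matrix_vector_mult_add_rdistrib outer_product_mult_vec
        flip: scaleR_matrix_vector_assoc matrix_vector_mul_assoc)
  also have "\<dots> = ?z - (?r * (y \<bullet> ?z)) *\<^sub>R s + (?r * (s \<bullet> v)) *\<^sub>R s"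
    by (simp add: matrix_vector_mult_diff_rdistrib outer_product_mult_vec
        flip: scaleR_matrix_vector_assoc)
  finally show ?thesis
    by (simp add: inner_diff_left inner_diff_right inner_add_right inner_commute)
qed

lemma sym_iff_inner:
  fixes H :: "real ^ 'n ^ 'n"
  shows "transpose H = H \<longleftrightarrow> (\<forall>u v. u \<bullet> (H *v v) = v \<bullet> (H *v u))"
proof
  assume "transpose H = H"
  then show "\<forall>u v. u \<bullet> (H *v v) = v \<bullet> (H *v u)"
    by (metis dot_lmul_matrix inner_commute transpose_matrix_vector)
next
  assume *: "\<forall>u v. u \<bullet> (H *v v) = v \<bullet> (H *v u)"
  have "transpose H *v v = H *v v" for v
    by (rule vector_eq_rdot[THEN iffD1]) (metis * dot_lmul_matrix inner_commute transpose_matrix_vector)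
  then show "transpose H = H"
    by (simp add: matrix_eq)
qed

text \<open>The two summands of the quadratic form cannot vanish together: if \<open>s \<bullet> v = 0\<close>, the substituted
  vector in the first summand is \<open>v\<close> itself.\<close>

lemma sym_pos_def_bfgs_update:
  fixes H :: "real ^ 'n ^ 'n"
  assumes "sym_pos_def H" and "s \<bullet> y > 0"
  shows "sym_pos_def (bfgs_update H s y)"
  unfolding sym_pos_def_def
proof (intro conjI allI impI)
  have sym: "u \<bullet> (H *v v) = v \<bullet> (H *v u)" for u v
    using assms(1) by (simp add: sym_pos_def_def sym_iff_inner)
  have pos: "v \<bullet> (H *v v) > 0" if "v \<noteq> 0" for v
    using assms(1) that by (simp add: sym_pos_def_def)
  show "transpose (bfgs_update H s y) = bfgs_update H s y"
    unfolding sym_iff_inner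
  proof (intro allI)
    fix u v :: "real ^ 'n"
    show "u \<bullet> (bfgs_update H s y *v v) = v \<bullet> (bfgs_update H s y *v u)"
      unfolding inner_bfgs_update
      by (subst sym) (simp only: mult_ac)
  qed
  fix v :: "real ^ 'n" assume "v \<noteq> 0"
  let ?q = "v - (inverse (s \<bullet> y) * (s \<bullet> v)) *\<^sub>R y"
  have *: "v \<bullet> (bfgs_update H s y *v v) = ?q \<bullet> (H *v ?q) + inverse (s \<bullet> y) * (s \<bullet> v)\<^sup>2"
    by (simp add: inner_bfgs_update power2_eq_square)
  show "0 < v \<bullet> (bfgs_update H s y *v v)"
  proof (cases "s \<bullet> v = 0")
    case True
    then show ?thesis using * pos[OF \<open>v \<noteq> 0\<close>] by simp
  next
    case False
    then have "inverse (s \<bullet> y) * (s \<bullet> v)\<^sup>2 > 0" using assms(2) by simp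
    moreover have "?q \<bullet> (H *v ?q) \<ge> 0" using pos[of ?q] by (cases "?q = 0") auto
    ultimately show ?thesis using * by linarith
  qed
qed

section \<open>The update when the gradient difference lies along the kink normal\<close>

text \<open>For the direction \<open>p = - H (u + w)\<close> this is \<open>(w \<bullet> p) / (u \<bullet> p)\<close>.\<close>

definition slope_ratio :: "real ^ 'n ^ 'n \<Rightarrow> real ^ 'n \<Rightarrow> real ^ 'n \<Rightarrow> real" where
  "slope_ratio H u w = (w \<bullet> (H *v (u + w))) / (u \<bullet> (H *v (u + w)))"

text \<open>The coefficient \<open>slope_ratio H u w\<close> is the one for which \<open>q\<close> is \<open>H\<close>-conjugate to the gradient
  \<open>u + w\<close>, that is, orthogonal to the step \<open>s\<close>. The update does not change the quadratic form on
  vectors orthogonal to \<open>s\<close>, which is why \<open>q \<bullet> (H *v q)\<close> reappears in the next matrix.\<close>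

definition conj_energy :: "real ^ 'n ^ 'n \<Rightarrow> real ^ 'n \<Rightarrow> real ^ 'n \<Rightarrow> real" where
  "conj_energy H u w = (let q = w - slope_ratio H u w *\<^sub>R u in q \<bullet> (H *v q))"

text \<open>The setting is one iteration with step \<open>- \<alpha> H (u + w)\<close> from gradient \<open>u + w\<close> to gradient
  \<open>- u + w\<close>.\<close>

context
  fixes H H' :: "real ^ 'n ^ 'n" and u w :: "real ^ 'n" and \<alpha> t r E :: real
  assumes spd: "sym_pos_def H" and \<alpha>: "\<alpha> > 0" and slope: "u \<bullet> (H *v (u + w)) > 0"
    and H': "H' = bfgs_update H (- (\<alpha> *\<^sub>R (H *v (u + w)))) (- (2 *\<^sub>R u))"
    and t: "t = \<alpha> * (u \<bullet> (H *v (u + w))) / 2"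
    and r: "r = slope_ratio H u w"
    and E: "E = conj_energy H u w"
begin

text \<open>Since \<open>y\<close> is a multiple of \<open>u\<close>, the substitution \<open>v \<mapsto> v - \<rho> (s \<bullet> v) y\<close> kills \<open>u\<close> and takes \<open>w\<close> to
  \<open>q = w - r u\<close>. The old matrix thus contributes only \<open>E = q \<bullet> H q\<close>, and the rest comes from the
  rank-one term \<open>\<rho> s s\<^sup>T\<close>.\<close>

private lemma inner_update:
  "u \<bullet> (H' *v u) = t"
  "u \<bullet> (H' *v w) = t * r"
  "w \<bullet> (H' *v w) = E + t * r\<^sup>2"
proof -
  define p where "p = u \<bullet> (H *v (u + w))"
  define q where "q = w \<bullet> (H *v (u + w))"
  define s where "s = - (\<alpha> *\<^sub>R (H *v (u + w)))"
  have H's: "H' = bfgs_update H s (- (2 *\<^sub>R u))" by (simp only: H' s_def)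
  have p: "p > 0" using slope by (simp add: p_def)
  have s: "s \<bullet> u = - \<alpha> * p" "s \<bullet> w = - \<alpha> * q"
    by (simp_all add: s_def p_def q_def inner_commute)
  have r': "r = q / p" by (simp add: r slope_ratio_def p_def q_def)
  have t': "t = \<alpha> * p / 2" by (simp add: t p_def)
  have sy: "s \<bullet> (- (2 *\<^sub>R u)) = 2 * \<alpha> * p" using s by simp
  have coeff: "inverse (2 * \<alpha> * p) * (- \<alpha> * p) = - (1 / 2)"
    "inverse (2 * \<alpha> * p) * (- \<alpha> * q) = - (r / 2)"
    using p \<alpha> by (simp_all add: r' field_simps)
  have Au: "u - (inverse (s \<bullet> (- (2 *\<^sub>R u))) * (s \<bullet> u)) *\<^sub>R (- (2 *\<^sub>R u)) = 0"
    unfolding sy s coeff by simp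
  have Aw: "w - (inverse (s \<bullet> (- (2 *\<^sub>R u))) * (s \<bullet> w)) *\<^sub>R (- (2 *\<^sub>R u)) = w - r *\<^sub>R u"
    unfolding sy s coeff by simp
  show "u \<bullet> (H' *v u) = t"
    unfolding H's inner_bfgs_update Au unfolding sy s coeff by (simp add: t')
  show "u \<bullet> (H' *v w) = t * r"
    unfolding H's inner_bfgs_update Au unfolding sy s coeff using p by (simp add: t' r')
  show "w \<bullet> (H' *v w) = E + t * r\<^sup>2"
    unfolding H's inner_bfgs_update Aw unfolding sy s coeff using p
    by (simp add: E conj_energy_def Let_def t' power2_eq_square flip: r) (simp add: r')
qed

private lemma inner_update_commute: "w \<bullet> (H' *v u) = t * r"
proof -
  have "- (\<alpha> *\<^sub>R (H *v (u + w))) \<bullet> (- (2 *\<^sub>R u)) > 0"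
    using slope \<alpha> by (simp add: inner_commute)
  then have "sym_pos_def H'"
    unfolding H' by (rule sym_pos_def_bfgs_update[OF spd])
  then show ?thesis
    unfolding sym_pos_def_def sym_iff_inner by (metis inner_update(2))
qed

text \<open>This quantity must be positive if the next step is to cross the kink, which is the source of
  the bound \<open>r < 1\<close>.\<close>

lemma next_slope: "- u \<bullet> (H' *v (- u + w)) = t * (1 - r)"
  by (simp add: matrix_vector_mult_diff_distrib inner_diff_right inner_update right_diff_distrib)

lemma conj_energy_eq:
  assumes "r < 1"
  shows "t * (1 - r) * (r + slope_ratio H' (- u) w) = E"
proof -
  have "w \<bullet> (H' *v (- u + w)) = E + t * r\<^sup>2 - t * r"
    by (simp add: matrix_vector_mult_diff_distrib inner_diff_right inner_update inner_update_commute)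
  then have "slope_ratio H' (- u) w = (E + t * r\<^sup>2 - t * r) / (t * (1 - r))"
    unfolding slope_ratio_def next_slope by simp
  moreover have "t * (1 - r) \<noteq> 0" using assms slope \<alpha> by (auto simp: t)
  ultimately have "t * (1 - r) * slope_ratio H' (- u) w = E + t * r\<^sup>2 - t * r"
    by simp
  then show ?thesis by (simp add: algebra_simps power2_eq_square)
qed

lemma conj_energy_next:
  "conj_energy H' (- u) w = E + t * (r + slope_ratio H' (- u) w)\<^sup>2"
  by (simp add: conj_energy_def Let_def matrix_vector_right_distrib matrix_vector_mult_scaleR
      inner_add_left inner_add_right inner_update inner_update_commute)
    (simp add: power2_eq_square algebra_simps)

end

section \<open>The line search on a function with a kink\<close>

lemma abs_inner_GDERIV:
  assumes "x \<bullet> e \<noteq> 0"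
  shows "GDERIV (\<lambda>x. \<bar>x \<bullet> e\<bar> + x \<bullet> w) x :> sgn (x \<bullet> e) *\<^sub>R e + w"
proof -
  have lin: "GDERIV (\<lambda>x. x \<bullet> v) x :> v" for v
    unfolding gderiv_def by (auto intro!: derivative_eq_intros)
  have "DERIV norm (x \<bullet> e) :> sgn (x \<bullet> e)"
    using GDERIV_norm[OF assms] unfolding gderiv_deriv .
  then have "DERIV abs (x \<bullet> e) :> sgn (x \<bullet> e)" by (simp only: real_norm_def[abs_def])
  from GDERIV_DERIV_compose[OF lin this] show ?thesis
    by (intro GDERIV_add lin) simp
qed

text \<open>Restricted to the line through \<open>x\<close> in direction \<open>e\<close>, the function has a minimum at the kink after
  subtraction of the linear function with either of two different slopes, so a derivative would have
  to equal both.\<close>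

lemma abs_inner_differentiable_imp_nonzero:
  assumes "(\<lambda>x. \<bar>x \<bullet> e\<bar> + x \<bullet> w) differentiable (at x)" and "e \<noteq> 0"
  shows "x \<bullet> e \<noteq> 0"
proof
  assume x: "x \<bullet> e = 0"
  let ?f = "\<lambda>x. \<bar>x \<bullet> e\<bar> + x \<bullet> w"
  have "?f differentiable (at (x + 0 *\<^sub>R e))" using assms(1) by simp
  then have "(?f \<circ> (\<lambda>h. x + h *\<^sub>R e)) differentiable (at 0)"
    by (intro differentiable_chain_at) auto
  then have "(\<lambda>h. ?f (x + h *\<^sub>R e)) differentiable (at 0)" by (simp add: o_def)
  then obtain d where d: "((\<lambda>h. ?f (x + h *\<^sub>R e)) has_real_derivative d) (at 0)"
    using real_differentiable_def by blast
  have slope: "d = c" if c: "\<And>h. c * h \<le> \<bar>h\<bar> * (e \<bullet> e) + h * (e \<bullet> w)" for c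
  proof -
    have "((\<lambda>h. ?f (x + h *\<^sub>R e) - c * h) has_real_derivative d - c) (at 0)"
      by (intro DERIV_diff d DERIV_cmult_Id)
    then have "d - c = 0"
    proof (rule DERIV_local_min[where d = 1])
      show "\<forall>h. \<bar>0 - h\<bar> < 1 \<longrightarrow> ?f (x + 0 *\<^sub>R e) - c * 0 \<le> ?f (x + h *\<^sub>R e) - c * h"
        using c by (simp add: inner_add_left x abs_mult algebra_simps)
    qed simp
    then show ?thesis by simp
  qed
  have "d = e \<bullet> w"
    by (rule slope) (simp add: mult.commute)
  moreover have "d = e \<bullet> w + e \<bullet> e"
  proof (rule slope)
    fix h :: real
    have "h * (e \<bullet> e) \<le> \<bar>h\<bar> * (e \<bullet> e)" by (intro mult_right_mono) auto
    then show "(e \<bullet> w + e \<bullet> e) * h \<le> \<bar>h\<bar> * (e \<bullet> e) + h * (e \<bullet> w)"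
      by (simp add: algebra_simps)
  qed
  ultimately show False using assms(2) by simp
qed

text \<open>Without a crossing the directional derivative would stay the same negative number, contrary to
  the curvature condition with \<open>c2 < 1\<close>. The change of \<open>x \<bullet> e\<close> is then the sum of the two distances
  to the kink, and with this the sufficient decrease condition becomes a lower bound on the distance
  at the start.\<close>

lemma armijo_wolfe_crosses_kink:
  fixes H :: "real ^ 'n ^ 'n" and e w x :: "real ^ 'n"
  defines "f \<equiv> \<lambda>x. \<bar>x \<bullet> e\<bar> + x \<bullet> w"
    and "u \<equiv> sgn (x \<bullet> e) *\<^sub>R e"
  assumes spd: "sym_pos_def H" and x: "x \<bullet> e \<noteq> 0" and g: "u + w \<noteq> 0" and "e \<noteq> 0" "c2 < 1"
    and x': "x' = x - \<alpha> *\<^sub>R (H *v (u + w))"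
    and aw: "armijo_wolfe c1 c2 f x (- (H *v (u + w))) \<alpha>"
  shows "x' \<bullet> e \<noteq> 0" and "sgn (x' \<bullet> e) = - sgn (x \<bullet> e)"
    and "\<bar>x \<bullet> e\<bar> + \<bar>x' \<bullet> e\<bar> = \<alpha> * (u \<bullet> (H *v (u + w)))"
    and "u \<bullet> (H *v (u + w)) > 0"
    and "\<bar>x \<bullet> e\<bar> \<ge> \<alpha> * (u \<bullet> (H *v (u + w))) / 2 * (1 - slope_ratio H u w + c1 * (1 + slope_ratio H u w))"
proof -
  define p where "p = u \<bullet> (H *v (u + w))"
  define q where "q = w \<bullet> (H *v (u + w))"
  have x'_eq: "x + \<alpha> *\<^sub>R - (H *v (u + w)) = x'" by (simp add: x')
  have grad: "gradient f x = u + w"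
    unfolding f_def u_def by (rule gradient_eq[OF abs_inner_GDERIV[OF x]])
  have \<alpha>: "\<alpha> > 0" and diff: "f differentiable (at x')"
    and armijo: "f x' \<le> f x - c1 * \<alpha> * (p + q)"
    and wolfe: "gradient f x' \<bullet> (H *v (u + w)) \<le> c2 * (p + q)"
    using aw unfolding armijo_wolfe_def x'_eq grad
    by (simp_all add: p_def q_def inner_add_left algebra_simps)
  have pq: "p + q > 0"
    using spd g unfolding sym_pos_def_def p_def q_def by (simp flip: inner_add_left)
  show x'_ne: "x' \<bullet> e \<noteq> 0"
    using diff \<open>e \<noteq> 0\<close> unfolding f_def by (rule abs_inner_differentiable_imp_nonzero)
  have grad': "gradient f x' = sgn (x' \<bullet> e) *\<^sub>R e + w"
    unfolding f_def by (rule gradient_eq[OF abs_inner_GDERIV[OF x'_ne]])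
  have "sgn (x' \<bullet> e) \<noteq> sgn (x \<bullet> e)"
  proof
    assume "sgn (x' \<bullet> e) = sgn (x \<bullet> e)"
    then have "p + q \<le> c2 * (p + q)"
      using wolfe by (simp add: grad' p_def q_def inner_add_left u_def)
    then show False using pq \<open>c2 < 1\<close> by simp
  qed
  then show sgn': "sgn (x' \<bullet> e) = - sgn (x \<bullet> e)"
    using x x'_ne by (auto simp: sgn_if split: if_splits)
  have "sgn (x \<bullet> e) * (x' \<bullet> e) = \<bar>x \<bullet> e\<bar> - \<alpha> * p"
    by (simp add: x' inner_diff_left p_def u_def inner_commute abs_sgn algebra_simps)
  moreover have "\<bar>x' \<bullet> e\<bar> = - (sgn (x \<bullet> e) * (x' \<bullet> e))"
    using sgn' by (simp add: abs_sgn mult.commute)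
  ultimately have cross: "\<bar>x \<bullet> e\<bar> + \<bar>x' \<bullet> e\<bar> = \<alpha> * p" by simp
  then show "\<bar>x \<bullet> e\<bar> + \<bar>x' \<bullet> e\<bar> = \<alpha> * (u \<bullet> (H *v (u + w)))" by (simp add: p_def)
  have "\<alpha> * p > 0" using cross x by linarith
  then have p: "p > 0" using \<alpha> by (simp add: zero_less_mult_iff)
  then show "u \<bullet> (H *v (u + w)) > 0" by (simp add: p_def)
  have "x' \<bullet> w = x \<bullet> w - \<alpha> * q" by (simp add: x' inner_diff_left q_def inner_commute[of _ w] inner_diff_right)
  then have "\<bar>x' \<bullet> e\<bar> \<le> \<bar>x \<bullet> e\<bar> + \<alpha> * q - c1 * \<alpha> * (p + q)"
    using armijo by (simp add: f_def)
  then have "\<alpha> * (p - q + c1 * (p + q)) / 2 \<le> \<bar>x \<bullet> e\<bar>"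
    using cross by (simp add: algebra_simps)
  moreover have "slope_ratio H u w = q / p" by (simp add: slope_ratio_def p_def q_def)
  ultimately show "\<bar>x \<bullet> e\<bar> \<ge> \<alpha> * (u \<bullet> (H *v (u + w))) / 2 * (1 - slope_ratio H u w + c1 * (1 + slope_ratio H u w))"
    using p by (simp add: field_simps flip: p_def)
qed

section \<open>Contradiction from the scalar recursion\<close>

lemma no_infinite_scalar_run:
  fixes r E t \<xi> :: "nat \<Rightarrow> real"
  assumes r: "\<And>k. -1 < r k" "\<And>k. r k < 1"
    and E: "\<And>k. 0 < E k" and t: "\<And>k. 0 < t k" and \<xi>: "\<And>k. 0 < \<xi> k"
    and c: "0 < c" "c < 1"
    and ratio: "\<And>k. t k * (1 - r k) * (r k + r (Suc k)) = E k"
    and energy: "\<And>k. E (Suc k) = E k + t k * (r k + r (Suc k))\<^sup>2"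
    and cross: "\<And>k. \<xi> k + \<xi> (Suc k) = 2 * t k"
    and decr: "\<And>k. \<xi> k \<ge> t k * (1 - r k + c * (1 + r k))"
  shows False
proof -
  have sum_pos: "r k + r (Suc k) > 0" for k
  proof -
    have "t k * (1 - r k) > 0" using t r by simp
    then show ?thesis using ratio[of k] E[of k] by (metis zero_less_mult_pos)
  qed
  have E_Suc: "E (Suc k) * (1 - r k) = E k * (1 + r (Suc k))" for k
  proof -
    have "E (Suc k) * (1 - r k) = E k * (1 - r k) + (t k * (1 - r k) * (r k + r (Suc k))) * (r k + r (Suc k))"
      unfolding energy by (simp add: algebra_simps power2_eq_square)
    then show ?thesis unfolding ratio by (simp add: algebra_simps)
  qed
  have E_le: "E k \<le> 2 * \<xi> k" for k
  proof -
    have "E k \<le> t k * (1 - r k) * 2"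
      unfolding ratio[of k, symmetric] using t[of k] r[of k] r[of "Suc k"] by (intro mult_left_mono) auto
    moreover have "t k * (1 - r k) \<le> t k * (1 - r k + c * (1 + r k))"
      using t[of k] r[of k] c by (intro mult_left_mono) auto
    ultimately show ?thesis using decr[of k] by linarith
  qed
  have \<xi>_Suc: "\<xi> (Suc k) * (1 - r k) \<le> (1 - c) * \<xi> k * (1 + r k)" for k
  proof -
    have "\<xi> (Suc k) \<le> (1 - c) * (t k * (1 + r k))"
      using decr[of k] cross[of k] by (simp add: algebra_simps)
    then have "\<xi> (Suc k) * (1 - r k) \<le> (1 - c) * (t k * (1 + r k)) * (1 - r k)"
      using r[of k] by (intro mult_right_mono) auto
    also have "\<dots> = (1 - c) * (1 + r k) * (t k * (1 - r k))" by simp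
    also have "\<dots> \<le> (1 - c) * (1 + r k) * \<xi> k"
    proof (rule mult_left_mono)
      have "t k * (1 - r k) \<le> t k * (1 - r k + c * (1 + r k))"
        using t[of k] r[of k] c by (intro mult_left_mono) auto
      then show "t k * (1 - r k) \<le> \<xi> k" using decr[of k] by linarith
    qed (use c r[of k] in auto)
    finally show ?thesis by (simp add: mult_ac)
  qed
  \<comment> \<open>The bounds for \<open>\<xi>\<close> and \<open>E\<close> share the factor \<open>1 / (1 - r k)\<close>; it cancels in \<open>\<xi> / E\<close>, and the factor
    \<open>1 + r k\<close> makes what remains telescope.\<close>
  define Q where "Q k = \<xi> k * (1 + r k) / E k" for k
  have Q_Suc: "Q (Suc k) \<le> (1 - c) * Q k" for k
  proof -
    have "Q (Suc k) = (\<xi> (Suc k) * (1 - r k)) * (1 + r (Suc k)) / (E (Suc k) * (1 - r k))"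
      using r[of k] E[of "Suc k"] by (simp add: Q_def)
    also have "\<dots> = \<xi> (Suc k) * (1 - r k) / E k"
      unfolding E_Suc using r[of "Suc k"] by simp
    also have "\<dots> \<le> (1 - c) * Q k"
      using \<xi>_Suc[of k] E[of k] by (simp add: Q_def divide_right_mono mult_ac)
    finally show ?thesis .
  qed
  have Q_le: "Q k \<le> (1 - c) ^ k * Q 0" for k
  proof (induction k)
    case (Suc k)
    have "(1 - c) * Q k \<le> (1 - c) * ((1 - c) ^ k * Q 0)"
      using Suc c by (intro mult_left_mono) auto
    then show ?case using Q_Suc[of k] by simp
  qed simp
  have Q_ge: "1 + r k \<le> 2 * Q k" for k
  proof -
    have "E k * (1 + r k) \<le> 2 * \<xi> k * (1 + r k)"
      using E_le[of k] r[of k] by (intro mult_right_mono) auto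
    then show ?thesis using E[of k] by (simp add: Q_def field_simps)
  qed
  have "(\<lambda>k. (1 - c) ^ k * Q 0) \<longlonglongrightarrow> 0 * Q 0"
    using c by (intro tendsto_intros LIMSEQ_power_zero) auto
  then have "\<forall>\<^sub>F k in sequentially. (1 - c) ^ k * Q 0 < 1 / 2"
    by (rule order_tendstoD) simp
  then obtain k where "(1 - c) ^ k * Q 0 < 1 / 2" "(1 - c) ^ Suc k * Q 0 < 1 / 2"
    unfolding eventually_sequentially by (meson le_SucI order_refl)
  then show False
    using Q_le[of k] Q_le[of "Suc k"] Q_ge[of k] Q_ge[of "Suc k"] sum_pos[of k] by linarith
qed

section \<open>Termination\<close>

text \<open>Independence of \<open>e\<close> and \<open>w\<close> keeps the gradients and the vectors \<open>q\<close> nonzero, hence \<open>E > 0\<close>.\<close>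

theorem bfgs_terminates_abs_inner:
  fixes e w x0 :: "real ^ 'n" and x :: "nat \<Rightarrow> real ^ 'n"
  defines "f \<equiv> \<lambda>x. \<bar>x \<bullet> e\<bar> + x \<bullet> w"
  assumes "e \<noteq> 0" and indep: "\<And>c. w \<noteq> c *\<^sub>R e"
    and c: "0 < c1" "c1 < 1" "c2 < 1"
    and spd0: "sym_pos_def H0"
    and diff0: "f differentiable (at x0)"
    and run: "bfgs_run c1 c2 f x0 H0 x H \<alpha>"
  shows "\<exists>k. bfgs_terminates_at c1 c2 f x H k"
proof (rule ccontr)
  assume "\<not> ?thesis"
  then have aw: "armijo_wolfe c1 c2 f (x k) (bfgs_direction f (x k) (H k)) (\<alpha> k)"
    and x_Suc: "x (Suc k) = x k + \<alpha> k *\<^sub>R bfgs_direction f (x k) (H k)"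
    and H_Suc: "H (Suc k) = bfgs_update (H k) (x (Suc k) - x k)
                  (gradient f (x (Suc k)) - gradient f (x k))"
    and init: "x 0 = x0" "H 0 = H0" for k
    using run unfolding bfgs_run_def by auto
  define u where "u k = sgn (x k \<bullet> e) *\<^sub>R e" for k
  define p where "p k = u k \<bullet> (H k *v (u k + w))" for k
  define t where "t k = \<alpha> k * p k / 2" for k
  define r where "r k = slope_ratio (H k) (u k) w" for k
  define E where "E k = conj_energy (H k) (u k) w" for k
  define \<xi> where "\<xi> k = \<bar>x k \<bullet> e\<bar>" for k
  have \<alpha>: "\<alpha> k > 0" for k using aw[of k] by (simp add: armijo_wolfe_def)
  have x_ne: "x k \<bullet> e \<noteq> 0" for k
  proof -
    have "f differentiable (at (x k))"
    proof (cases k)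
      case 0
      then show ?thesis using diff0 init by simp
    next
      case (Suc j)
      then show ?thesis using aw[of j] x_Suc[of j] by (simp add: armijo_wolfe_def)
    qed
    then show ?thesis using \<open>e \<noteq> 0\<close> unfolding f_def by (rule abs_inner_differentiable_imp_nonzero)
  qed
  have grad: "gradient f (x k) = u k + w" for k
    unfolding f_def u_def by (rule gradient_eq[OF abs_inner_GDERIV[OF x_ne]])
  have g_ne: "u k + w \<noteq> 0" for k
    using indep[of "- sgn (x k \<bullet> e)"] by (auto simp: u_def add_eq_0_iff)
  have dir: "bfgs_direction f (x k) (H k) = - (H k *v (u k + w))" for k
    by (simp add: bfgs_direction_def grad)
  have x_Suc': "x (Suc k) = x k - \<alpha> k *\<^sub>R (H k *v (u k + w))" for k
    by (simp add: x_Suc dir)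
  \<comment> \<open>Positive definiteness of \<open>H k\<close> remains a premise here, because its own inductive proof uses the
    crossing at step \<open>k\<close>.\<close>
  note kink = armijo_wolfe_crosses_kink[OF _ x_ne g_ne[unfolded u_def] \<open>e \<noteq> 0\<close> c(3)
      x_Suc'[unfolded u_def] aw[unfolded dir, unfolded f_def u_def], folded u_def]
  have H_Suc': "H (Suc k) = bfgs_update (H k) (- (\<alpha> k *\<^sub>R (H k *v (u k + w)))) (- (2 *\<^sub>R u k))"
    and u_Suc: "u (Suc k) = - u k" if "sym_pos_def (H k)" for k
  proof -
    show u: "u (Suc k) = - u k" using kink(2)[OF that] by (simp add: u_def)
    have y: "gradient f (x (Suc k)) - gradient f (x k) = - (2 *\<^sub>R u k)"
      unfolding grad u by (simp add: scaleR_2)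
    have "x (Suc k) - x k = - (\<alpha> k *\<^sub>R (H k *v (u k + w)))"
      by (simp add: x_Suc')
    then show "H (Suc k) = bfgs_update (H k) (- (\<alpha> k *\<^sub>R (H k *v (u k + w)))) (- (2 *\<^sub>R u k))"
      unfolding H_Suc[of k] y by (simp only:)
  qed
  have spd: "sym_pos_def (H k)" for k
  proof (induction k)
    case (Suc k)
    have "- (\<alpha> k *\<^sub>R (H k *v (u k + w))) \<bullet> (- (2 *\<^sub>R u k)) > 0"
      using kink(4)[OF Suc] \<alpha>[of k] by (simp add: inner_commute)
    then show ?case
      unfolding H_Suc'[OF Suc] by (rule sym_pos_def_bfgs_update[OF Suc])
  qed (simp add: init spd0)
  note H_Suc' = H_Suc'[OF spd] and u_Suc = u_Suc[OF spd] and kink = kink[OF spd]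
  have p: "p k > 0" for k using kink(4) by (simp add: p_def)
  have t: "t k > 0" for k using p \<alpha> by (simp add: t_def)
  have r_lt: "r k < 1" for k
  proof -
    have "t k * (1 - r k) = p (Suc k)"
      using next_slope[OF spd \<alpha> kink(4) refl refl refl refl, of k]
      by (simp add: p_def t_def r_def H_Suc' u_Suc)
    then have "1 - r k > 0" using t[of k] p[of "Suc k"] by (metis zero_less_mult_pos)
    then show ?thesis by simp
  qed
  show False
  proof (rule no_infinite_scalar_run[of r E t \<xi> c1])
    fix k
    have "(u k + w) \<bullet> (H k *v (u k + w)) > 0"
      using spd[of k] g_ne[of k] by (simp add: sym_pos_def_def)
    then show "-1 < r k"
      using p[of k] by (simp add: r_def slope_ratio_def p_def inner_add_left field_simps)
    have "w - r k *\<^sub>R u k \<noteq> 0"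
      using indep[of "r k * sgn (x k \<bullet> e)"] by (simp add: u_def)
    then show "0 < E k"
      using spd[of k] by (simp add: E_def conj_energy_def Let_def sym_pos_def_def r_def)
    show "t k * (1 - r k) * (r k + r (Suc k)) = E k"
      using conj_energy_eq[OF spd \<alpha> kink(4) refl refl refl refl r_lt[unfolded r_def], of k]
      by (simp add: p_def t_def r_def E_def H_Suc' u_Suc)
    show "E (Suc k) = E k + t k * (r k + r (Suc k))\<^sup>2"
      using conj_energy_next[OF spd \<alpha> kink(4) refl refl refl refl, of k]
      by (simp add: p_def t_def r_def E_def H_Suc' u_Suc)
    show "\<xi> k + \<xi> (Suc k) = 2 * t k"
      using kink(3)[of k] by (simp add: \<xi>_def t_def p_def)
    show "\<xi> k \<ge> t k * (1 - r k + c1 * (1 + r k))"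
      using kink(5)[of k] by (simp add: \<xi>_def t_def p_def r_def)
    show "0 < \<xi> k" using x_ne by (simp add: \<xi>_def)
  qed (use r_lt t c in auto)
qed

theorem mainTheorem1:
  fixes a :: "'n::finite"
    and c1 c2 :: real
    and x0 :: "real ^ 'n"
    and H0 :: "real ^ 'n ^ 'n"
    and x :: "nat \<Rightarrow> real ^ 'n"
    and H :: "nat \<Rightarrow> real ^ 'n ^ 'n"
    and \<alpha> :: "nat \<Rightarrow> real"
  assumes "CARD('n) \<ge> 2"
    and "0 < c1" and "c1 < c2" and "c2 < 1"
    and "sym_pos_def H0"
    and "abs_plus_sum a differentiable (at x0)"
    and "bfgs_run c1 c2 (abs_plus_sum a) x0 H0 x H \<alpha>"
  shows "\<exists>k. bfgs_terminates_at c1 c2 (abs_plus_sum a) x H k"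
proof -
  define e :: "real ^ 'n" where "e = axis a 1"
  define w :: "real ^ 'n" where "w = (\<Sum>i\<in>UNIV - {a}. axis i 1)"
  have f: "abs_plus_sum a = (\<lambda>x. \<bar>x \<bullet> e\<bar> + x \<bullet> w)"
    by (rule ext) (simp add: abs_plus_sum_def e_def w_def inner_sum_right inner_axis)
  have "UNIV \<noteq> {a}"
  proof
    assume "UNIV = {a}"
    then have "CARD('n) = card {a}" by (rule arg_cong)
    then show False using assms(1) by simp
  qed
  then obtain b where b: "b \<noteq> a" by blast
  have w_b: "w $ b = 1"
    using b by (simp add: w_def axis_def)
  have "w \<noteq> c *\<^sub>R e" for c
    using w_b b by (auto simp: e_def axis_def)
  moreover have "e \<noteq> 0" by (simp add: e_def axis_eq_0_iff)
  ultimately show ?thesis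
    using assms unfolding f by (intro bfgs_terminates_abs_inner) auto
qed

end
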